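(* Let $B=\{b_j : 1\le j\le s\}\subset K[x_1][\tilde x]\setminus K[x_1]$ be a finite set of polynomials. For every $f\in K[x_1][\tilde x]$ there exist a multiplier $\lambda\in K[x_1]\setminus\{0\}$, a remainder $r\in K[x_1][\tilde x]$ and quotients $q_j\in K[x_1][\tilde x]$ for $1\le j\le s$ such that $$\lambda f=\sum_{j=1}^s q_j b_j+r,$$ where $r$ is properly reduced with respect to $B$ and the multiplier $\lambda$ is a product of least multipliers of proper term reductions. Moreover, $$\mathrm{LM}(f)=\max\bigl\{\max_{1\le j\le s}\{\mathrm{LM}(q_j b_j)\},\ \mathrm{LM}(r)\bigr\}.$$
   Context: Let $K$ be a field, $\tilde x=(x_2,\dots,x_n)$, and regard $K[x_1,\dots,x_n]$ as the algebra $K[x_1][\tilde x]$ over $K[x_1]$. Let $[\tilde x]$ be the set of monomials $\tilde x^\alpha=x_2^{\alpha_2}\cdots x_n^{\alpha_n}$, ordered by the lexicographic ordering with $x_2\prec\cdots\prec x_n$. For $f=\sum_\alpha c_\alpha\tilde x^\alpha$ with $c_\alpha\in K[x_1]$, let $\mathrm{supp}(f)=\{\tilde x^\alpha : c_\alpha\neq0\}$. For $f\ne 0$, $\mathrm{LM}(f)\in[\tilde x]$ is the largest monomial in $\mathrm{supp}(f)$, $\mathrm{LC}(f)\in K[x_1]\setminus\{0\}$ is its coefficient, and $\mathrm{LT}(f)=\mathrm{LC}(f)\mathrm{LM}(f)$. Convention: zero polynomials are ignored in maxima of leading monomials ($\mathrm{LM}(0)$ counts as smaller than every monomial). For nonzero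 $a,b\in K[x_1]$, $\gcd(a,b)$ is monic and $\mathrm{lcm}(a,b)=ab/\gcd(a,b)$. Proper term reduction: let $f\in K[x_1][\tilde x]\setminus K[x_1]$ and $g\in K[x_1][\tilde x]\setminus\{0\}$, and let $c_\alpha\tilde x^\alpha$ be a term of $f$ with $\tilde x^\alpha\in\mathrm{supp}(f)$ divisible by $\mathrm{LM}(g)$. The proper term reduction of $c_\alpha\tilde x^\alpha$ by $g$ is the passage from $f$ to $h=\mu f-\frac{m\,\tilde x^\alpha}{\mathrm{LT}(g)}g$, where $m=\mathrm{lcm}(c_\alpha,\mathrm{LC}(g))$ and $\mu=m/c_\alpha\in K[x_1]\setminus\{0\}$ is called the least multiplier. The multiplier $\lambda$ in the theorem is a (possibly empty) product of the least multipliers arising in successive proper term reductions, starting from $f$, by elements of $B$. A polynomial $r\in K[x_1][\tilde x]$ is properly reduced with respect to $B$ if no monomial in $\mathrm{supp}(r)$ lies in the ideal $\langle \mathrm{LM}(b) : b\in B\rangle$, i.e. no monomial of $r$ is divisible by some $\mathrm{LM}(b)$ with $b\in B$ (in particular $r=0$ is properly reduced). *)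

theory Defs
  imports "HOL-Computational_Algebra.Computational_Algebra" "HOL-Library.Poly_Mapping"
begin

abbreviation keys :: "('a \<Rightarrow>\<^sub>0 'b::zero) \<Rightarrow> 'a set" where
  "keys \<equiv> Poly_Mapping.keys"

abbreviation lookup :: "('a \<Rightarrow>\<^sub>0 'b::zero) \<Rightarrow> 'a \<Rightarrow> 'b" where
  "lookup \<equiv> Poly_Mapping.lookup"

text \<open>
  The coefficient ring $K[x_1]$ is \<open>'k poly\<close>.  A monomial $\tilde x^\alpha$ is its exponent vector
  \<open>\<alpha>\<close>, where \<open>lookup \<alpha> i\<close> is the exponent of $x_i$; multiplication of monomials is addition.  The
  product on \<open>'k mpoly\<close> is the convolution product.  The type allows all variable indices; the
  restriction to $x_2, \dots, x_n$ is made by \<open>mpolys n\<close>.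
\<close>

type_synonym monom = "nat \<Rightarrow>\<^sub>0 nat"
type_synonym 'k mpoly = "monom \<Rightarrow>\<^sub>0 'k poly"

definition mpolys :: "nat \<Rightarrow> ('k::field) mpoly set" where
  "mpolys n = {f. \<forall>\<alpha>\<in>keys f. keys \<alpha> \<subseteq> {2..n}}"

definition const :: "('k::field) poly \<Rightarrow> 'k mpoly" where
  "const c = Poly_Mapping.single 0 c"

definition x_pow :: "monom \<Rightarrow> ('k::field) mpoly" where
  "x_pow \<alpha> = Poly_Mapping.single \<alpha> 1"

text \<open>
  The linear order on \<open>nat \<Rightarrow>\<^sub>0 nat\<close> from the library gives precedence to the smallest index, but
  $x_2 \prec \dots \prec x_n$ requires the largest index to be decisive.
\<close>

definition lex_less :: "monom \<Rightarrow> monom \<Rightarrow> bool" where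
  "lex_less \<alpha> \<beta> \<longleftrightarrow>
     (\<exists>i. lookup \<alpha> i < lookup \<beta> i \<and> (\<forall>j>i. lookup \<alpha> j = lookup \<beta> j))"

definition lex_le :: "monom \<Rightarrow> monom \<Rightarrow> bool" where
  "lex_le \<alpha> \<beta> \<longleftrightarrow> \<alpha> = \<beta> \<or> lex_less \<alpha> \<beta>"

lemma lex_less_trans:
  assumes "lex_less \<alpha> \<beta>" and "lex_less \<beta> \<gamma>"
  shows "lex_less \<alpha> \<gamma>"
proof -
  obtain i where i: "lookup \<alpha> i < lookup \<beta> i" "\<forall>j>i. lookup \<alpha> j = lookup \<beta> j"
    using assms(1) unfolding lex_less_def by blast
  obtain k where k: "lookup \<beta> k < lookup \<gamma> k" "\<forall>j>k. lookup \<beta> j = lookup \<gamma> j"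
    using assms(2) unfolding lex_less_def by blast
  have "lookup \<alpha> (max i k) < lookup \<gamma> (max i k)"
    using i k by (cases i k rule: linorder_cases) (auto simp: max_def)
  moreover have "\<forall>j>max i k. lookup \<alpha> j = lookup \<gamma> j"
    using i k by simp
  ultimately show ?thesis unfolding lex_less_def by blast
qed

lemma lex_less_irrefl: "\<not> lex_less \<alpha> \<alpha>"
  by (simp add: lex_less_def)

lemma lex_less_total:
  assumes "\<alpha> \<noteq> \<beta>"
  shows "lex_less \<alpha> \<beta> \<or> lex_less \<beta> \<alpha>"
proof -
  let ?D = "{i. lookup \<alpha> i \<noteq> lookup \<beta> i}"
  have "?D \<subseteq> keys \<alpha> \<union> keys \<beta>"
    by (auto simp: in_keys_iff)
  then have fin: "finite ?D" by (rule finite_subset) simp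
  have ne: "?D \<noteq> {}" using assms poly_mapping_eqI[of \<alpha> \<beta>] by blast
  define i where "i = Max ?D"
  have i: "lookup \<alpha> i \<noteq> lookup \<beta> i" using Max_in[OF fin ne] by (simp add: i_def)
  have "\<forall>j>i. lookup \<alpha> j = lookup \<beta> j"
  proof (intro allI impI)
    fix j assume "j > i"
    then have "j \<notin> ?D" using Max_ge[OF fin, of j] unfolding i_def by linarith
    then show "lookup \<alpha> j = lookup \<beta> j" by simp
  qed
  with i show ?thesis unfolding lex_less_def by (metis linorder_neqE_nat)
qed

interpretation lex: linorder lex_le lex_less
  by unfold_locales
     (use lex_less_trans lex_less_irrefl lex_less_total in \<open>unfold lex_le_def, blast+\<close>)

text \<open>\<open>None\<close> is the leading monomial of the zero polynomial; it is below every monomial.\<close>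

definition LM :: "('k::field) mpoly \<Rightarrow> monom option" where
  "LM f = (if f = 0 then None else Some (lex.Max (keys f)))"

definition LC :: "('k::field) mpoly \<Rightarrow> 'k poly" where
  "LC f = (case LM f of None \<Rightarrow> 0 | Some \<alpha> \<Rightarrow> lookup f \<alpha>)"

fun lm_le :: "monom option \<Rightarrow> monom option \<Rightarrow> bool" where
  "lm_le None _ = True"
| "lm_le (Some \<alpha>) None = False"
| "lm_le (Some \<alpha>) (Some \<beta>) = lex_le \<alpha> \<beta>"

definition lm_less :: "monom option \<Rightarrow> monom option \<Rightarrow> bool" where
  "lm_less u v \<longleftrightarrow> lm_le u v \<and> \<not> lm_le v u"

interpretation lm: linorder lm_le lm_less
proof
  fix u v w :: "monom option"
  show "lm_less u v \<longleftrightarrow> lm_le u v \<and> \<not> lm_le v u" by (rule lm_less_def)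
  show "lm_le u u" by (cases u) auto
  show "lm_le u v \<Longrightarrow> lm_le v w \<Longrightarrow> lm_le u w"
    by (cases u; cases v; cases w) (auto intro: lex.order_trans)
  show "lm_le u v \<Longrightarrow> lm_le v u \<Longrightarrow> u = v"
    by (cases u; cases v) auto
  show "lm_le u v \<or> lm_le v u"
    by (cases u; cases v) (auto intro: lex.linear)
qed

text \<open>
  The library's \<open>gcd\<close> on \<open>'k poly\<close> needs more type class structure on \<open>'k\<close> than \<open>field\<close>.
\<close>

definition is_monic_gcd :: "('k::field) poly \<Rightarrow> 'k poly \<Rightarrow> 'k poly \<Rightarrow> bool" where
  "is_monic_gcd a b d \<longleftrightarrow>
     lead_coeff d = 1 \<and> d dvd a \<and> d dvd b \<and> (\<forall>e. e dvd a \<and> e dvd b \<longrightarrow> e dvd d)"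

definition monic_gcd :: "('k::field) poly \<Rightarrow> 'k poly \<Rightarrow> 'k poly" where
  "monic_gcd a b = (THE d. is_monic_gcd a b d)"

definition poly_lcm :: "('k::field) poly \<Rightarrow> 'k poly \<Rightarrow> 'k poly" where
  "poly_lcm a b = a * b div monic_gcd a b"

lemma ex_gcd:
  fixes a b :: "('k::field) poly"
  shows "\<exists>d. d dvd a \<and> d dvd b \<and> (\<forall>e. e dvd a \<and> e dvd b \<longrightarrow> e dvd d)"
proof (induction "if b = 0 then 0 else Suc (degree b)" arbitrary: a b rule: less_induct)
  case less
  show ?case
  proof (cases "b = 0")
    case True
    then show ?thesis by (intro exI[of _ a]) auto
  next
    case False
    have "(if a mod b = 0 then 0 else Suc (degree (a mod b))) < (if b = 0 then 0 else Suc (degree b))"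
      using False degree_mod_less[of b a] by auto
    from less[OF this] obtain d where d: "d dvd b" "d dvd a mod b"
      "\<forall>e. e dvd b \<and> e dvd a mod b \<longrightarrow> e dvd d" by blast
    have "d dvd a" using d(1,2) by (simp add: dvd_mod_iff)
    then show ?thesis using d by (metis dvd_mod)
  qed
qed

lemma ex1_monic_gcd:
  fixes a b :: "('k::field) poly"
  assumes "a \<noteq> 0"
  shows "\<exists>!d. is_monic_gcd a b d"
proof -
  obtain d where d: "d dvd a" "d dvd b" "\<forall>e. e dvd a \<and> e dvd b \<longrightarrow> e dvd d"
    using ex_gcd by blast
  have d0: "d \<noteq> 0" using d(1) assms by auto
  define c where "c = smult (inverse (lead_coeff d)) d"
  have "is_monic_gcd a b c"
    using d d0 by (auto simp: is_monic_gcd_def c_def smult_dvd_iff dvd_smult)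
  moreover have "p = q" if "is_monic_gcd a b p" "is_monic_gcd a b q" for p q
  proof -
    have lc: "lead_coeff p = 1" "lead_coeff q = 1" and dvd: "p dvd q" "q dvd p"
      using that by (auto simp: is_monic_gcd_def)
    obtain k l where k: "q = p * k" and l: "p = q * l" using dvd unfolding dvd_def by blast
    have "p \<noteq> 0" using lc by auto
    moreover have "p * (k * l) = p * 1" by (metis k l mult.assoc mult_1_right)
    ultimately have "k * l = 1" by (metis mult_left_cancel)
    then have "k dvd 1" by (metis dvd_triv_left)
    then obtain c where c: "k = [:c:]" by (auto elim: is_unit_polyE)
    have "lead_coeff q = lead_coeff p * lead_coeff k" unfolding k by (rule lead_coeff_mult)
    then have "c = 1" using lc c by simp
    then show "p = q" using k c by simp
  qed
  ultimately show ?thesis by blast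
qed

lemma is_monic_gcd_monic_gcd: "a \<noteq> 0 \<Longrightarrow> is_monic_gcd a b (monic_gcd a b)"
  unfolding monic_gcd_def by (rule theI') (rule ex1_monic_gcd)

text \<open>
  \<open>proper_term_reduction n f g \<alpha> \<mu> h\<close>: the term of \<open>f\<close> at \<open>\<alpha>\<close> is reduced by \<open>g\<close>, with result \<open>h\<close>
  and least multiplier \<open>\<mu>\<close>.  Here $m\,\tilde x^\alpha / \mathrm{LT}(g)$ is the term with coefficient
  \<open>m div LC g\<close> and monomial \<open>\<gamma>\<close>; both divisions \<open>div\<close> are exact.
\<close>

definition proper_term_reduction ::
  "nat \<Rightarrow> ('k::field) mpoly \<Rightarrow> 'k mpoly \<Rightarrow> monom \<Rightarrow> 'k poly \<Rightarrow> 'k mpoly \<Rightarrow> bool" where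
  "proper_term_reduction n f g \<alpha> \<mu> h \<longleftrightarrow>
     f \<in> mpolys n - range const \<and> g \<in> mpolys n - {0} \<and> \<alpha> \<in> keys f \<and>
     (\<exists>\<beta> \<gamma> m. LM g = Some \<beta> \<and> \<alpha> = \<beta> + \<gamma> \<and> m = poly_lcm (lookup f \<alpha>) (LC g) \<and>
        \<mu> = m div lookup f \<alpha> \<and>
        h = const \<mu> * f - const (m div LC g) * x_pow \<gamma> * g)"

text \<open>
  \<open>term_reductions n B f l h\<close>: finitely many (possibly no) successive proper term reductions by
  elements of \<open>B\<close> lead from \<open>f\<close> to \<open>h\<close>, and \<open>l\<close> is the product of their least multipliers.
\<close>

inductive term_reductions ::
  "nat \<Rightarrow> ('k::field) mpoly set \<Rightarrow> 'k mpoly \<Rightarrow> 'k poly \<Rightarrow> 'k mpoly \<Rightarrow> bool"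
  for n B f where
  refl: "term_reductions n B f 1 f"
| step: "term_reductions n B f l h \<Longrightarrow> g \<in> B \<Longrightarrow> proper_term_reduction n h g \<alpha> \<mu> h' \<Longrightarrow>
    term_reductions n B f (\<mu> * l) h'"

text \<open>The ideal of \<open>mpolys n\<close> generated by a finite set \<open>S\<close>.\<close>

definition ideal_gen :: "nat \<Rightarrow> ('k::field) mpoly set \<Rightarrow> 'k mpoly set" where
  "ideal_gen n S = {\<Sum>p\<in>S. c p * p | c. \<forall>p\<in>S. c p \<in> mpolys n}"

definition properly_reduced :: "nat \<Rightarrow> ('k::field) mpoly set \<Rightarrow> 'k mpoly \<Rightarrow> bool" where
  "properly_reduced n B r \<longleftrightarrow>
     (\<forall>\<alpha>\<in>keys r. x_pow \<alpha> \<notin> ideal_gen n {x_pow \<beta> :: 'k mpoly | \<beta> b. b \<in> B \<and> LM b = Some \<beta>})"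

end

theory Submission
  imports Defs
begin

text \<open>
  The division algorithm is the greedy one: as long as the current polynomial \<open>h\<close> contains a
  monomial divisible by some \<open>LM (b j)\<close>, reduce the \<^emph>\<open>largest\<close> such monomial \<open>\<alpha>\<close>.  The subtracted
  multiple of \<open>b j\<close> has leading monomial exactly \<open>\<alpha>\<close>, and \<open>h\<close> is only multiplied by a nonzero
  element of $K[x_1]$.  Hence the term at \<open>\<alpha>\<close> disappears, the support above \<open>\<alpha>\<close> does not change,
  and whatever is created lies below \<open>\<alpha>\<close>.  So the largest reducible monomial strictly decreases
  (\<open>division_state_step\<close>).  Since the lexicographic order on exponent vectors with support in a
  fixed finite set of indices is well-founded (\<open>wf_lex_less_bounded\<close>), the process stops, and it
  stops only at a properly reduced polynomial.

  The statement on leading monomials rests on an invariant: each monomial of \<open>h\<close> and of the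
  products \<open>q j * b j\<close> is at most \<open>LM f\<close>.  A step preserves it, because all it creates is at most
  \<open>\<alpha>\<close>, and \<open>\<alpha>\<close> occurs in \<open>h\<close>.  This bounds the maximum from above.  Conversely \<open>LM f\<close> is the leading
  monomial of \<open>const l * f\<close>, since $K[x_1]$ is a domain and \<open>l \<noteq> 0\<close>; the leading monomial of a
  sum never exceeds the maximum over the summands.
\<close>

section \<open>Well-foundedness of the monomial order\<close>

text \<open>
  Reading an exponent vector from its largest index downwards, as a list of fixed length, turns
  \<open>lex_less\<close> into the ordinary lexicographic order on such lists.
\<close>

lemma wf_lex_less_bounded:
  "wf {(\<alpha>, \<beta>). keys \<alpha> \<subseteq> {..N} \<and> keys \<beta> \<subseteq> {..N} \<and> lex_less \<alpha> \<beta>}"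
proof -
  let ?v = "\<lambda>\<alpha>::monom. map (lookup \<alpha>) (rev [0..<Suc N])"
  have "(\<alpha>, \<beta>) \<in> inv_image (lexn less_than (Suc N)) ?v"
    if \<alpha>: "keys \<alpha> \<subseteq> {..N}" and \<beta>: "keys \<beta> \<subseteq> {..N}" and less: "lex_less \<alpha> \<beta>" for \<alpha> \<beta>
  proof -
    obtain i where i: "lookup \<alpha> i < lookup \<beta> i" "\<forall>j>i. lookup \<alpha> j = lookup \<beta> j"
      using less unfolding lex_less_def by blast
    have "i \<in> keys \<beta>" using i(1) by (simp add: in_keys_iff)
    then have "i \<le> N" using \<beta> by auto
    have "[0..<Suc N] = [0..<i] @ [i..<Suc N]"
      using \<open>i \<le> N\<close> by (metis le_SucI le_add_diff_inverse upt_add_eq_append zero_le)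
    also have "[i..<Suc N] = i # [Suc i..<Suc N]"
      using \<open>i \<le> N\<close> by (simp add: upt_conv_Cons)
    finally have split: "rev [0..<Suc N] = rev [Suc i..<Suc N] @ i # rev [0..<i]" by simp
    have v: "?v \<gamma> = map (lookup \<gamma>) (rev [Suc i..<Suc N]) @ lookup \<gamma> i # map (lookup \<gamma>) (rev [0..<i])"
      for \<gamma> by (simp only: split map_append list.map)
    have "map (lookup \<alpha>) (rev [Suc i..<Suc N]) = map (lookup \<beta>) (rev [Suc i..<Suc N])"
      by (rule map_cong[OF HOL.refl]) (use i(2) in auto)
    moreover have "(lookup \<alpha> i, lookup \<beta> i) \<in> less_than" using i(1) by simp
    ultimately have "\<exists>xys x y xs ys. ?v \<alpha> = xys @ x # xs \<and> ?v \<beta> = xys @ y # ys \<and> (x, y) \<in> less_than"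
      unfolding v by metis
    moreover have "length (?v \<alpha>) = Suc N" "length (?v \<beta>) = Suc N" by simp_all
    ultimately have "(?v \<alpha>, ?v \<beta>) \<in> lexn less_than (Suc N)"
      unfolding lexn_conv mem_Collect_eq case_prod_conv by (intro conjI)
    then show ?thesis by (simp only: in_inv_image)
  qed
  then show ?thesis
    by (intro wf_subset[OF wf_inv_image[OF wf_lexn[OF wf_less_than]]]) blast
qed

lemma lex_le_add_left: "lex_le \<alpha> \<beta> \<Longrightarrow> lex_le (\<gamma> + \<alpha>) (\<gamma> + \<beta>)"
  unfolding lex_le_def lex_less_def by (auto simp: lookup_add)

section \<open>Polynomials over the coefficient ring\<close>

lemma lookup_single_mult:
  fixes g :: "'a::cancel_comm_monoid_add \<Rightarrow>\<^sub>0 'b::semiring_0"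
  shows "lookup (Poly_Mapping.single \<gamma> c * g) (\<gamma> + \<delta>) = c * lookup g \<delta>"
  by (simp add: lookup_mult lookup_single when_mult Sum_any_when_equal')

lemma lookup_const_mult [simp]: "lookup (const c * f) \<delta> = c * lookup f \<delta>"
  using lookup_single_mult[of 0 c f \<delta>] by (simp add: const_def)

lemma const_mult: "const (a * b) = const a * const b"
  by (simp add: const_def mult_single)

lemma keys_const_mult: "c \<noteq> 0 \<Longrightarrow> keys (const c * f) = keys f"
  by (auto simp: in_keys_iff)

lemma keys_add_monom: "keys (\<alpha> + \<beta> :: monom) = keys \<alpha> \<union> keys \<beta>"
  by (auto simp: in_keys_iff lookup_add)

lemma mpolys_add: "f \<in> mpolys n \<Longrightarrow> g \<in> mpolys n \<Longrightarrow> f + g \<in> mpolys n"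
  unfolding mpolys_def using keys_add[of f g] by blast

lemma mpolys_mult: "f \<in> mpolys n \<Longrightarrow> g \<in> mpolys n \<Longrightarrow> f * g \<in> mpolys n"
proof -
  assume fg: "f \<in> mpolys n" "g \<in> mpolys n"
  have "keys \<delta> \<subseteq> {2..n}" if \<delta>: "\<delta> \<in> keys (f * g)" for \<delta>
  proof -
    obtain \<alpha> \<beta> where "\<alpha> \<in> keys f" "\<beta> \<in> keys g" "\<delta> = \<alpha> + \<beta>"
      using subsetD[OF keys_mult \<delta>] by blast
    moreover from this have "keys \<alpha> \<subseteq> {2..n}" "keys \<beta> \<subseteq> {2..n}"
      using fg by (simp_all add: mpolys_def)
    ultimately show ?thesis by (simp add: keys_add_monom)
  qed
  then show ?thesis by (simp add: mpolys_def)
qed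

lemma mpolys_diff: "f \<in> mpolys n \<Longrightarrow> g \<in> mpolys n \<Longrightarrow> f - g \<in> mpolys n"
  unfolding mpolys_def using keys_diff[of f g] by blast

lemma mpolys_single: "keys \<gamma> \<subseteq> {2..n} \<Longrightarrow> Poly_Mapping.single \<gamma> c \<in> mpolys n"
  by (simp add: mpolys_def)

lemma mpolys_const: "const c \<in> mpolys n"
  unfolding const_def by (rule mpolys_single) simp

lemma LM_zero [simp]: "LM 0 = None"
  by (simp add: LM_def)

lemma LM_SomeD:
  assumes "LM g = Some \<beta>"
  shows "\<beta> \<in> keys g" and "\<And>\<delta>. \<delta> \<in> keys g \<Longrightarrow> lex_le \<delta> \<beta>"
proof -
  have "g \<noteq> 0" and \<beta>: "\<beta> = lex.Max (keys g)" using assms by (auto simp: LM_def split: if_splits)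
  then have "keys g \<noteq> {}" by simp
  then show "\<beta> \<in> keys g" and "\<And>\<delta>. \<delta> \<in> keys g \<Longrightarrow> lex_le \<delta> \<beta>"
    unfolding \<beta> by (simp_all add: lex.Max_in)
qed

lemma LM_const_mult: "c \<noteq> 0 \<Longrightarrow> LM (const c * f) = LM f"
  using keys_const_mult[of c f] keys_eq_empty[of f] keys_eq_empty[of "const c * f"]
  by (simp add: LM_def)

text \<open>
  Bounds on leading monomials are best expressed through the whole support: in this form they
  are visibly stable under sums, without case distinctions for cancelling leading terms.
\<close>

lemma LM_le_iff: "lm_le (LM f) u \<longleftrightarrow> (\<forall>\<delta>\<in>keys f. lm_le (Some \<delta>) u)"
proof (cases "LM f")
  case None
  then show ?thesis by (auto simp: LM_def split: if_splits)
next
  case (Some \<beta>)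
  have "lm_le (Some \<delta>) u" if "lm_le (Some \<beta>) u" "\<delta> \<in> keys f" for \<delta>
    using that LM_SomeD(2)[OF Some] lm.order_trans[of "Some \<delta>" "Some \<beta>" u] by simp
  then show ?thesis using Some LM_SomeD(1)[OF Some] by auto
qed

lemma LM_add_le: "lm_le (LM f) u \<Longrightarrow> lm_le (LM g) u \<Longrightarrow> lm_le (LM (f + g)) u"
  unfolding LM_le_iff using keys_add[of f g] by blast

lemma LM_diff_le: "lm_le (LM f) u \<Longrightarrow> lm_le (LM g) u \<Longrightarrow> lm_le (LM (f - g)) u"
  unfolding LM_le_iff using keys_diff[of f g] by blast

lemma LM_sum_le:
  "finite A \<Longrightarrow> (\<And>j. j \<in> A \<Longrightarrow> lm_le (LM (F j)) u) \<Longrightarrow> lm_le (LM (sum F A)) u"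
  by (induction A rule: finite_induct) (auto intro: LM_add_le)

text \<open>
  The monomial $1$ is the smallest one, so as a leading monomial it would force the support into
  \<open>{0}\<close>.  Consequently a polynomial with a monomial divisible by the leading monomial of a
  nonconstant \<open>g\<close> is itself nonconstant, as a proper term reduction requires.
\<close>

lemma LM_nonconst:
  assumes "g \<notin> range const" and "LM g = Some \<beta>"
  shows "\<beta> \<noteq> 0"
proof
  assume "\<beta> = 0"
  have "\<delta> = 0" if "\<delta> \<in> keys g" for \<delta>
    using LM_SomeD(2)[OF assms(2) that] \<open>\<beta> = 0\<close> by (auto simp: lex_le_def lex_less_def)
  then have "g = const (lookup g 0)"
    by (intro poly_mapping_eqI) (auto simp: const_def lookup_single when_def in_keys_iff)
  with assms(1) show False by blast
qed

lemma dvd_poly_lcm: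
  assumes "a \<noteq> 0"
  shows "a dvd poly_lcm a b" and "b dvd poly_lcm a b"
    and "b \<noteq> 0 \<Longrightarrow> poly_lcm a b \<noteq> 0"
proof -
  define d where "d = monic_gcd a b"
  have "is_monic_gcd a b d" unfolding d_def by (rule is_monic_gcd_monic_gcd[OF assms])
  then have d: "d dvd a" "d dvd b" by (simp_all add: is_monic_gcd_def)
  then obtain u v where u: "a = d * u" and v: "b = d * v" by (auto elim!: dvdE)
  have "d \<noteq> 0" "u \<noteq> 0" using u assms by auto
  then have lcm: "poly_lcm a b = d * u * v"
    unfolding poly_lcm_def d_def[symmetric] by (simp add: u v ac_simps)
  then show "a dvd poly_lcm a b" "b dvd poly_lcm a b" by (simp_all add: u v)
  show "b \<noteq> 0 \<Longrightarrow> poly_lcm a b \<noteq> 0" using lcm v \<open>d \<noteq> 0\<close> \<open>u \<noteq> 0\<close> by simp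
qed

section \<open>A single reduction\<close>

text \<open>
  Both scaled coefficients at \<open>\<alpha>\<close> equal the least common multiple, so they cancel; nothing above \<open>\<alpha>\<close>
  is touched, because \<open>t * g\<close> has support at most \<open>\<alpha>\<close>.
\<close>

lemma ex_proper_term_reduction:
  fixes h g :: "('k::field) mpoly"
  assumes h: "h \<in> mpolys n" and g: "g \<in> mpolys n - range const"
    and \<alpha>: "\<alpha> \<in> keys h" and LMg: "LM g = Some \<beta>" and \<alpha>_eq: "\<alpha> = \<beta> + \<gamma>"
  obtains \<mu> t where "proper_term_reduction n h g \<alpha> \<mu> (const \<mu> * h - t * g)"
    and "\<mu> \<noteq> 0" and "t \<in> mpolys n" and "lm_le (LM (t * g)) (Some \<alpha>)"
    and "lookup (const \<mu> * h - t * g) \<alpha> = 0"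
proof
  define c where "c = lookup h \<alpha>"
  define m where "m = poly_lcm c (LC g)"
  define \<mu> where "\<mu> = m div c"
  define t where "t = const (m div LC g) * x_pow \<gamma>"
  have t_single: "t = Poly_Mapping.single \<gamma> (m div LC g)"
    by (simp add: t_def const_def x_pow_def mult_single)
  have c: "c \<noteq> 0" using \<alpha> by (simp add: c_def in_keys_iff)
  have LCg: "LC g = lookup g \<beta>" "LC g \<noteq> 0"
    using LMg LM_SomeD(1)[OF LMg] by (simp_all add: LC_def in_keys_iff)
  have m: "c dvd m" "LC g dvd m" "m \<noteq> 0"
    unfolding m_def using dvd_poly_lcm[OF c] LCg(2) by blast+
  show "\<mu> \<noteq> 0" unfolding \<mu>_def using m by (metis dvd_div_eq_0_iff)
  have "\<alpha> \<noteq> 0"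
    using LM_nonconst[OF _ LMg] g unfolding \<alpha>_eq
    by (metis DiffD2 Un_empty keys_add_monom keys_eq_empty)
  then have "h \<notin> range const" using \<alpha> by (auto simp: const_def split: if_splits)
  moreover have "g \<noteq> 0" using LMg by (auto simp: LM_def)
  ultimately show "proper_term_reduction n h g \<alpha> \<mu> (const \<mu> * h - t * g)"
    unfolding proper_term_reduction_def
    using h g \<alpha> LMg \<alpha>_eq by (auto simp: \<mu>_def t_def m_def c_def)
  have "keys \<alpha> \<subseteq> {2..n}" using h \<alpha> by (auto simp: mpolys_def)
  then have "keys \<gamma> \<subseteq> {2..n}" by (simp add: \<alpha>_eq keys_add_monom)
  then show "t \<in> mpolys n" unfolding t_single by (rule mpolys_single)
  have "lex_le \<delta> \<alpha>" if "\<delta> \<in> keys (t * g)" for \<delta>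
  proof -
    obtain \<epsilon> where \<epsilon>: "\<epsilon> \<in> keys g" "\<delta> = \<gamma> + \<epsilon>"
      using keys_mult[of t g] \<open>\<delta> \<in> keys (t * g)\<close> by (auto simp: t_single split: if_splits)
    then show ?thesis
      using lex_le_add_left[OF LM_SomeD(2)[OF LMg \<epsilon>(1)], of \<gamma>] by (simp add: \<alpha>_eq add.commute)
  qed
  then show "lm_le (LM (t * g)) (Some \<alpha>)" by (simp add: LM_le_iff)
  have "lookup (t * g) \<alpha> = m"
    using lookup_single_mult[of \<gamma> "m div LC g" g \<beta>] m(2) LCg(1)
    by (simp add: t_single \<alpha>_eq add.commute)
  moreover have "lookup (const \<mu> * h) \<alpha> = m" using m(1) by (simp add: \<mu>_def c_def)
  ultimately show "lookup (const \<mu> * h - t * g) \<alpha> = 0" by (simp add: lookup_minus)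
qed

section \<open>Reducible monomials\<close>

definition reducible :: "('k::field) mpoly set \<Rightarrow> 'k mpoly \<Rightarrow> monom set" where
  "reducible B h = {\<alpha> \<in> keys h. \<exists>g\<in>B. \<exists>\<beta> \<gamma>. LM g = Some \<beta> \<and> \<alpha> = \<beta> + \<gamma>}"

lemma finite_reducible [simp]: "finite (reducible B h)"
  by (simp add: reducible_def)

text \<open>
  Membership in a monomial ideal is divisibility by a generator: a monomial in the support of a
  sum already occurs in one of the summands.
\<close>

lemma properly_reduced_if_irreducible:
  fixes r :: "('k::field) mpoly"
  assumes "reducible B r = {}"
  shows "properly_reduced n B r"
  unfolding properly_reduced_def
proof (intro ballI notI)
  fix \<alpha>
  let ?S = "{x_pow \<beta> :: 'k mpoly | \<beta> b. b \<in> B \<and> LM b = Some \<beta>}"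
  assume \<alpha>: "\<alpha> \<in> keys r" and "x_pow \<alpha> \<in> ideal_gen n ?S"
  then obtain c where c: "x_pow \<alpha> = (\<Sum>p\<in>?S. c p * p)" by (auto simp: ideal_gen_def)
  have "(\<Sum>p\<in>?S. lookup (c p * p) \<alpha>) \<noteq> 0"
    using arg_cong[OF c, of "\<lambda>p. lookup p \<alpha>"] by (simp add: x_pow_def lookup_sum)
  then obtain p where p: "p \<in> ?S" "lookup (c p * p) \<alpha> \<noteq> 0" by (meson sum.neutral)
  then obtain \<beta> g where g: "g \<in> B" "LM g = Some \<beta>" and p_eq: "p = x_pow \<beta>" by blast
  have "\<alpha> \<in> keys (c p * p)" using p(2) by (simp add: in_keys_iff)
  then obtain \<gamma> where "\<alpha> = \<gamma> + \<beta>" using keys_mult[of "c p" p] by (auto simp: p_eq x_pow_def)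
  then have "\<alpha> \<in> reducible B r"
    using \<alpha> g by (auto simp: reducible_def add.commute)
  with assms show False by simp
qed

section \<open>The division algorithm\<close>

text \<open>The invariant of the algorithm, with current multiplier, polynomial and quotients.\<close>

definition division_state ::
  "nat \<Rightarrow> nat \<Rightarrow> (nat \<Rightarrow> ('k::field) mpoly) \<Rightarrow> 'k mpoly \<Rightarrow>
    'k poly \<Rightarrow> 'k mpoly \<Rightarrow> (nat \<Rightarrow> 'k mpoly) \<Rightarrow> bool" where
  "division_state n s b f l h q \<longleftrightarrow>
     l \<noteq> 0 \<and> h \<in> mpolys n \<and> (\<forall>j\<in>{1..s}. q j \<in> mpolys n) \<and>
     const l * f = (\<Sum>j=1..s. q j * b j) + h \<and>
     term_reductions n (b ` {1..s}) f l h \<and>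
     lm_le (LM h) (LM f) \<and> (\<forall>j\<in>{1..s}. lm_le (LM (q j * b j)) (LM f))"

text \<open>Reducing at the largest reducible monomial makes the largest reducible monomial drop.\<close>

lemma division_state_step:
  fixes b :: "nat \<Rightarrow> ('k::field) mpoly"
  assumes b: "b ` {1..s} \<subseteq> mpolys n - range const"
    and st: "division_state n s b f l h q"
    and \<alpha>: "\<alpha> \<in> reducible (b ` {1..s}) h"
    and max: "\<And>\<delta>. \<delta> \<in> reducible (b ` {1..s}) h \<Longrightarrow> lex_le \<delta> \<alpha>"
  obtains l' h' q' where "division_state n s b f l' h' q'"
    and "\<And>\<delta>. \<delta> \<in> reducible (b ` {1..s}) h' \<Longrightarrow> lex_less \<delta> \<alpha>"
proof -
  note S = st[unfolded division_state_def]
  from \<alpha> obtain k \<beta> \<gamma> where k: "k \<in> {1..s}" and LMk: "LM (b k) = Some \<beta>" and \<alpha>_eq: "\<alpha> = \<beta> + \<gamma>"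
    and \<alpha>h: "\<alpha> \<in> keys h" by (auto simp: reducible_def)
  have h: "h \<in> mpolys n" and bk: "b k \<in> mpolys n - range const" using S b k by blast+
  obtain \<mu> t where red: "proper_term_reduction n h (b k) \<alpha> \<mu> (const \<mu> * h - t * b k)"
    and \<mu>: "\<mu> \<noteq> 0" and t: "t \<in> mpolys n" and LMt: "lm_le (LM (t * b k)) (Some \<alpha>)"
    and zero: "lookup (const \<mu> * h - t * b k) \<alpha> = 0"
    using ex_proper_term_reduction[OF h bk \<alpha>h LMk \<alpha>_eq] .
  define h' where "h' = const \<mu> * h - t * b k"
  define q' where "q' j = const \<mu> * q j + (if j = k then t else 0)" for j
  have "lm_le (Some \<alpha>) (LM f)" using S \<alpha>h by (meson LM_le_iff)
  then have LMtf: "lm_le (LM (t * b k)) (LM f)" using LMt lm.order_trans by blast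
  have q'b: "q' j * b j = const \<mu> * (q j * b j) + (if j = k then t * b k else 0)" for j
    by (simp add: q'_def algebra_simps)
  have "division_state n s b f (\<mu> * l) h' q'"
    unfolding division_state_def
  proof (intro conjI ballI)
    show "\<mu> * l \<noteq> 0" using S \<mu> by simp
    show "h' \<in> mpolys n"
      unfolding h'_def using h t bk by (blast intro: mpolys_diff mpolys_mult mpolys_const)
    show "q' j \<in> mpolys n" if "j \<in> {1..s}" for j
    proof -
      have "(if j = k then t else 0) \<in> mpolys n" using t by (simp add: mpolys_def)
      then show ?thesis unfolding q'_def using S that by (blast intro: mpolys_add mpolys_mult mpolys_const)
    qed
    have "(\<Sum>j=1..s. q' j * b j) = const \<mu> * (\<Sum>j=1..s. q j * b j) + t * b k"
      unfolding q'b using k by (simp add: sum.distrib sum_distrib_left)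
    moreover have "const (\<mu> * l) * f = const \<mu> * ((\<Sum>j=1..s. q j * b j) + h)"
      using S by (simp add: const_mult mult.assoc)
    ultimately show "const (\<mu> * l) * f = (\<Sum>j=1..s. q' j * b j) + h'"
      by (simp add: h'_def algebra_simps)
    show "term_reductions n (b ` {1..s}) f (\<mu> * l) h'"
      using term_reductions.step[of n "b ` {1..s}" f l h "b k"] S k red unfolding h'_def by blast
    show "lm_le (LM h') (LM f)"
      unfolding h'_def using S LMtf by (intro LM_diff_le) (simp_all add: LM_const_mult \<mu>)
    show "lm_le (LM (q' j * b j)) (LM f)" if "j \<in> {1..s}" for j
      unfolding q'b using S LMtf that
      by (intro LM_add_le) (auto simp: LM_const_mult \<mu>)
  qed
  moreover have "lex_less \<delta> \<alpha>" if \<delta>: "\<delta> \<in> reducible (b ` {1..s}) h'" for \<delta>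
  proof (rule ccontr)
    assume "\<not> lex_less \<delta> \<alpha>"
    moreover have "\<delta> \<noteq> \<alpha>" using \<delta> zero by (auto simp: reducible_def h'_def in_keys_iff)
    ultimately have above: "\<not> lex_le \<delta> \<alpha>" by (simp add: lex_le_def)
    \<comment> \<open>Above \<open>\<alpha>\<close> the supports of \<open>h\<close> and \<open>h'\<close> agree, so \<open>\<delta>\<close> was reducible before the step.\<close>
    then have "\<delta> \<notin> keys (t * b k)" using LMt by (auto simp: LM_le_iff)
    then have "lookup h' \<delta> = \<mu> * lookup h \<delta>" by (simp add: h'_def lookup_minus in_keys_iff)
    then have "\<delta> \<in> reducible (b ` {1..s}) h" using \<delta> \<mu> by (auto simp: reducible_def in_keys_iff)
    with above max show False by blast
  qed
  ultimately show thesis by (rule that)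
qed

text \<open>
  Well-founded induction on the largest reducible monomial; since every polynomial reached stays
  in \<open>mpolys n\<close>, all these monomials have their support in \<open>{..n}\<close>.
\<close>

lemma division_terminates:
  fixes b :: "nat \<Rightarrow> ('k::field) mpoly"
  assumes b: "b ` {1..s} \<subseteq> mpolys n - range const"
    and st: "division_state n s b f l h q"
  shows "\<exists>l' r q'. division_state n s b f l' r q' \<and> reducible (b ` {1..s}) r = {}"
proof -
  let ?R = "\<lambda>h. reducible (b ` {1..s}) h"
  have keys_bounded: "keys \<alpha> \<subseteq> {..n}" if "division_state n s b f l h q" "\<alpha> \<in> ?R h" for \<alpha> l h q
    using that by (fastforce simp: division_state_def reducible_def mpolys_def)
  have main: "?thesis" if "division_state n s b f l h q" "\<alpha> \<in> ?R h" "\<forall>\<delta>\<in>?R h. lex_le \<delta> \<alpha>" for \<alpha> l h q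
    using that
  proof (induction \<alpha> arbitrary: l h q rule: wf_induct_rule[OF wf_lex_less_bounded[of n]])
    case (1 \<alpha>)
    from "1.prems" obtain l' h' q' where st': "division_state n s b f l' h' q'"
      and less: "\<And>\<delta>. \<delta> \<in> ?R h' \<Longrightarrow> lex_less \<delta> \<alpha>"
      using division_state_step[OF b, of f l h q \<alpha>] by metis
    show ?case
    proof (cases "?R h' = {}")
      case True
      with st' show ?thesis by blast
    next
      case False
      let ?\<beta> = "lex.Max (?R h')"
      have \<beta>: "?\<beta> \<in> ?R h'" "\<forall>\<delta>\<in>?R h'. lex_le \<delta> ?\<beta>" using False by (simp_all add: lex.Max_in)
      show ?thesis
        using "1.IH"[OF _ st' \<beta>] less[OF \<beta>(1)] keys_bounded[OF st' \<beta>(1)]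
          keys_bounded[OF "1.prems"(1,2)] by blast
    qed
  qed
  show ?thesis
  proof (cases "?R h = {}")
    case True
    with st show ?thesis by blast
  next
    case False
    then show ?thesis
      using main[OF st, of "lex.Max (?R h)"] by (simp add: lex.Max_in)
  qed
qed

theorem theorem3p4:
  fixes n s :: nat
    and b :: "nat \<Rightarrow> ('k::field) mpoly"
    and f :: "'k mpoly"
  assumes "b ` {1..s} \<subseteq> mpolys n - range const"
    and "f \<in> mpolys n"
  shows "\<exists>(l :: 'k poly) (r :: 'k mpoly) (q :: nat \<Rightarrow> 'k mpoly).
    l \<noteq> 0 \<and> r \<in> mpolys n \<and> (\<forall>j\<in>{1..s}. q j \<in> mpolys n) \<and>
    const l * f = (\<Sum>j=1..s. q j * b j) + r \<and>
    properly_reduced n (b ` {1..s}) r \<and>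
    term_reductions n (b ` {1..s}) f l r \<and>
    LM f = lm.Max (insert (LM r) ((\<lambda>j. LM (q j * b j)) ` {1..s}))"
proof -
  have "division_state n s b f 1 f (\<lambda>_. 0)"
    using assms(2) by (auto simp: division_state_def const_def mpolys_def
        intro: term_reductions.refl)
  from division_terminates[OF assms(1) this] obtain l r q
    where st: "division_state n s b f l r q" and irred: "reducible (b ` {1..s}) r = {}" by blast
  note S = st[unfolded division_state_def]
  let ?M = "insert (LM r) ((\<lambda>j. LM (q j * b j)) ` {1..s})"
  have "lm_le (lm.Max ?M) (LM f)" using S by (subst lm.Max_le_iff) auto
  moreover have "lm_le (LM (const l * f)) (lm.Max ?M)"
  proof -
    have le: "lm_le u (lm.Max ?M)" if "u \<in> ?M" for u
      using that by (intro lm.Max_ge) simp_all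
    have "lm_le (LM ((\<Sum>j=1..s. q j * b j) + r)) (lm.Max ?M)"
      by (intro LM_add_le LM_sum_le le) (simp_all del: lm.Max_insert)
    then show ?thesis using S by simp
  qed
  ultimately have "LM f = lm.Max ?M" using S by (metis LM_const_mult lm.order_antisym)
  with S properly_reduced_if_irreducible[OF irred] show ?thesis by blast
qed

end
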